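(* For any finite subset $Z$ of an ICC group $G$ the associated set $\mathfrak S_{\pm1}(Z)$ of $Z$-superswitching elements is infinite.
   Context: A group $G$ is an ICC group if $G\ne\{e\}$ and the conjugacy class of every non-identity element is infinite. Given a subset $Z\subset G$, an element $\sigma\in G$ is called $Z$-superswitching if the equality $\sigma x\sigma^{\varepsilon}=y$ with $x,y\in Z$ and $\varepsilon\in\{1,-1\}$ is only possible if $x=y=e$, where $e$ is the group identity. The set of all $Z$-superswitching elements is denoted by $\mathfrak S_{\pm1}(Z)$. *)

theory Defs
  imports "HOL-Algebra.Group"
begin

definition conjugacy_class :: "('a, 'b) monoid_scheme \<Rightarrow> 'a \<Rightarrow> 'a set" where
  "conjugacy_class G x = {g \<otimes>\<^bsub>G\<^esub> x \<otimes>\<^bsub>G\<^esub> inv\<^bsub>G\<^esub> g | g. g \<in> carrier G}"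

locale icc_group = group +
  assumes nontrivial: "carrier G \<noteq> {\<one>}"
    and infinite_conjugacy_class:
      "x \<in> carrier G \<Longrightarrow> x \<noteq> \<one> \<Longrightarrow> infinite (conjugacy_class G x)"

definition superswitching :: "('a, 'b) monoid_scheme \<Rightarrow> 'a set \<Rightarrow> 'a \<Rightarrow> bool" where
  "superswitching G Z \<sigma> \<longleftrightarrow> \<sigma> \<in> carrier G \<and>
     (\<forall>x\<in>Z. \<forall>y\<in>Z. \<forall>\<epsilon>\<in>{1, -1::int}.
        \<sigma> \<otimes>\<^bsub>G\<^esub> x \<otimes>\<^bsub>G\<^esub> (\<sigma> [^]\<^bsub>G\<^esub> \<epsilon>) = y \<longrightarrow> x = \<one>\<^bsub>G\<^esub> \<and> y = \<one>\<^bsub>G\<^esub>)"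

definition superswitching_set :: "('a, 'b) monoid_scheme \<Rightarrow> 'a set \<Rightarrow> 'a set" where
  "superswitching_set G Z = {\<sigma>. superswitching G Z \<sigma>}"

end

theory Submission
  imports Defs "HOL-Algebra.Coset" "HOL-Library.Ramsey"
begin

text \<open>
  An element \<open>\<sigma>\<close> fails to be superswitching for one of two reasons.

  Either it satisfies a conjugacy equation \<open>\<sigma>\<inverse>a\<sigma> = b\<close> with \<open>a \<noteq> \<one>\<close> from a finite
  list: \<open>\<sigma>x\<sigma>\<inverse> = y\<close> says that \<open>\<sigma>\<inverse>y\<sigma> = x\<close>, and \<open>\<sigma>x\<sigma> = y\<close> implies
  \<open>\<sigma>\<inverse>(yx)\<sigma> = xy\<close>, which is of this kind when \<open>yx \<noteq> \<one>\<close>. The solutions of such an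
  equation lie in one coset of the centralizer of \<open>a\<close>, which has infinite index because
  the conjugacy class of \<open>a\<close> is infinite. By a lemma of B. H. Neumann, finitely many
  cosets of subgroups of infinite index do not cover a group, so finitely many conjugacy
  equations can always be avoided simultaneously (\<open>ex_conj_avoids\<close>).

  Or \<open>\<sigma>x\<sigma> = x\<inverse>\<close> for some \<open>x \<in> Z\<close>, that is, \<open>\<sigma>x\<close> squares to \<open>\<one>\<close>. The solutions of this
  equation need not lie in finitely many cosets of subgroups of infinite index. But if
  \<open>s\<close>, \<open>t\<close> and \<open>st\<close> are all solutions for the same \<open>x\<close>, then \<open>t\<inverse>st = x\<^sup>2s\<close>
  (\<open>conj_of_inverted_products\<close>), which is again a conjugacy equation for \<open>t\<close> once
  \<open>s \<noteq> \<one>\<close> is given. Suppose every element avoiding a given finite list of conjugacy equations solved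
  \<open>\<sigma>x\<sigma> = x\<inverse>\<close> for some \<open>x\<close> in a finite set. Choose a sequence \<open>g\<^sub>0, g\<^sub>1, \<dots>\<close> so generic that
  all quotients \<open>g\<^sub>i\<inverse>g\<^sub>j\<close> with \<open>i < j\<close> avoid the list and that no \<open>t = g\<^sub>j\<inverse>g\<^sub>k\<close> satisfies
  \<open>t\<inverse>st = x\<^sup>2s\<close> with \<open>s = g\<^sub>i\<inverse>g\<^sub>j\<close>. Colouring each pair \<open>i < j\<close> by an \<open>x\<close> whose
  equation \<open>\<sigma>x\<sigma> = x\<inverse>\<close> is solved by \<open>g\<^sub>i\<inverse>g\<^sub>j\<close>, Ramsey's theorem yields a monochromatic triangle \<open>i < j < k\<close>, and its
  quotients \<open>s\<close>, \<open>t\<close>, \<open>st\<close> contradict the choice of the sequence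
  (\<open>ex_conj_avoids_not_inverting\<close>).

  Finally, finitely many elements \<open>s\<close> can be excluded by the equations
  \<open>\<sigma>\<inverse>a\<sigma> = s\<inverse>as\<close> for one fixed \<open>a \<noteq> \<one>\<close>. Hence no finite set contains all
  superswitching elements.
\<close>

section \<open>Neumann's lemma on coset coverings\<close>

text \<open>
  B. H. Neumann's lemma, by induction on the number of distinct subgroups. Since \<open>H\<close> has
  infinite index, some coset \<open>Hc\<close> is not among those listed, so the cosets of the other
  subgroups cover \<open>Hc\<close>. Right translates of this covering then cover every coset of \<open>H\<close>,
  and \<open>H\<close> can be dropped.
\<close>

lemma (in group) not_covered_by_cosets_of_infinite_index:
  assumes "finite \<H>"
    and "\<And>H. H \<in> \<H> \<Longrightarrow> subgroup H G \<and> infinite (rcosets H)"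
    and "\<And>H. H \<in> \<H> \<Longrightarrow> finite (T H) \<and> T H \<subseteq> carrier G"
  shows "\<not> carrier G \<subseteq> (\<Union>H\<in>\<H>. \<Union>t\<in>T H. H #> t)"
  using assms
proof (induction \<H> arbitrary: T rule: finite_induct)
  case empty
  then show ?case using one_closed by blast
next
  case (insert H \<H>)
  have H: "subgroup H G" "infinite (rcosets H)" "finite (T H)" "T H \<subseteq> carrier G"
    using insert.prems by auto
  then interpret H: subgroup H G by simp
  show ?case
  proof
    assume cover: "carrier G \<subseteq> (\<Union>K\<in>insert H \<H>. \<Union>t\<in>T K. K #> t)"
    have "\<not> rcosets H \<subseteq> (\<lambda>t. H #> t) ` T H"
      using H(2,3) finite_subset by blast
    then obtain c where c: "c \<in> carrier G" "H #> c \<notin> (\<lambda>t. H #> t) ` T H"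
      by (auto simp: RCOSETS_def)
    have new: "y \<in> (\<Union>K\<in>\<H>. \<Union>s\<in>T K. K #> s)" if y: "y \<in> H #> c" for y
    proof -
      have "y \<notin> H #> t" if "t \<in> T H" for t
        using that y c H repr_independence[OF y c(1) H(1)]
          repr_independence[of y H t] by auto
      moreover have "y \<in> carrier G"
        using y c r_coset_subset_G[OF H.subset] by blast
      ultimately show ?thesis using cover by blast
    qed
    \<comment> \<open>From \<open>Hc \<subseteq> \<Union> Ks\<close> it follows that \<open>Ht = Hc(c\<inverse>t) \<subseteq> \<Union> K(sc\<inverse>t)\<close>.\<close>
    define T' where "T' K = T K \<union> (\<Union>t\<in>T H. (\<lambda>s. s \<otimes> inv c \<otimes> t) ` T K)" for K
    have "carrier G \<subseteq> (\<Union>K\<in>\<H>. \<Union>s\<in>T' K. K #> s)"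
    proof
      fix g assume "g \<in> carrier G"
      then consider (old) K s where "K \<in> \<H>" "s \<in> T K" "g \<in> K #> s"
        | (H) t where "t \<in> T H" "g \<in> H #> t"
        using cover by blast
      then show "g \<in> (\<Union>K\<in>\<H>. \<Union>s\<in>T' K. K #> s)"
      proof cases
        case old
        then show ?thesis unfolding T'_def by blast
      next
        case (H t)
        then obtain h where h: "h \<in> H" "g = h \<otimes> t"
          by (auto simp: r_coset_def)
        have "h \<otimes> c \<in> H #> c" using h by (auto simp: r_coset_def)
        then obtain K s where K: "K \<in> \<H>" "s \<in> T K" "h \<otimes> c \<in> K #> s"
          using new by blast
        then obtain k where k: "k \<in> K" "h \<otimes> c = k \<otimes> s"
          by (auto simp: r_coset_def)
        have K_sub: "subgroup K G" "T K \<subseteq> carrier G" using insert.prems K(1) by auto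
        have mem: "k \<in> carrier G" "s \<in> carrier G" "t \<in> carrier G" "h \<in> carrier G"
          using subgroup.mem_carrier[OF K_sub(1) k(1)] K_sub(2) K(2) H(1) h(1)
            \<open>T H \<subseteq> carrier G\<close> by auto
        have "g = (h \<otimes> c) \<otimes> inv c \<otimes> t"
          using h mem c by (simp add: m_assoc)
        also have "\<dots> = k \<otimes> (s \<otimes> inv c \<otimes> t)"
          using k mem c by (simp add: m_assoc)
        finally have "g \<in> K #> (s \<otimes> inv c \<otimes> t)"
          using k by (auto simp: r_coset_def)
        moreover have "s \<otimes> inv c \<otimes> t \<in> T' K"
          using K H by (auto simp: T'_def)
        ultimately show ?thesis using K by blast
      qed
    qed
    moreover have "finite (T' K) \<and> T' K \<subseteq> carrier G" if "K \<in> \<H>" for K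
    proof -
      have "finite (T K)" "T K \<subseteq> carrier G" using insert.prems that by auto
      then show ?thesis using H c by (auto simp: T'_def)
    qed
    ultimately show False
      using insert.IH[of T'] insert.prems by blast
  qed
qed

section \<open>Generic elements of ICC groups\<close>

lemma (in group) inv_mult_cancel:
  assumes "a \<in> carrier G" "b \<in> carrier G"
  shows "inv a \<otimes> (a \<otimes> b) = b" "a \<otimes> (inv a \<otimes> b) = b"
  using assms by (simp_all add: m_assoc[symmetric])

definition (in group) centralizer :: "'a \<Rightarrow> 'a set" where
  "centralizer a = {c \<in> carrier G. a \<otimes> c = c \<otimes> a}"

lemma (in group) subgroup_centralizer:
  assumes "a \<in> carrier G"
  shows "subgroup (centralizer a) G"
proof
  show "inv c \<in> centralizer a" if "c \<in> centralizer a" for c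
  proof -
    have c: "c \<in> carrier G" "a \<otimes> c = c \<otimes> a" using that by (auto simp: centralizer_def)
    have "inv c \<otimes> (a \<otimes> c) \<otimes> inv c = inv c \<otimes> (c \<otimes> a) \<otimes> inv c" using c by simp
    then have "inv c \<otimes> a = a \<otimes> inv c" using c(1) assms
      by (simp add: m_assoc inv_mult_cancel)
    then show ?thesis using c by (simp add: centralizer_def)
  qed
  show "c \<otimes> d \<in> centralizer a" if "c \<in> centralizer a" "d \<in> centralizer a" for c d
  proof -
    have mem: "c \<in> carrier G" "d \<in> carrier G" and comm: "a \<otimes> c = c \<otimes> a" "a \<otimes> d = d \<otimes> a"
      using that by (auto simp: centralizer_def)
    have "a \<otimes> (c \<otimes> d) = c \<otimes> (a \<otimes> d)"
      using mem assms comm(1) by (simp add: m_assoc[symmetric])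
    also have "\<dots> = (c \<otimes> d) \<otimes> a"
      unfolding comm(2) using mem assms by (simp add: m_assoc)
    finally show ?thesis using mem by (simp add: centralizer_def)
  qed
qed (use assms in \<open>auto simp: centralizer_def\<close>)

lemma (in group) conj_eq_iff_mem_centralizer_coset:
  assumes "a \<in> carrier G" "g \<in> carrier G" "t \<in> carrier G"
  shows "g \<in> centralizer a #> t \<longleftrightarrow> inv g \<otimes> a \<otimes> g = inv t \<otimes> a \<otimes> t"
proof
  assume "g \<in> centralizer a #> t"
  then obtain c where c: "c \<in> carrier G" "a \<otimes> c = c \<otimes> a" "g = c \<otimes> t"
    unfolding r_coset_def centralizer_def by blast
  have "inv g \<otimes> a \<otimes> g = inv t \<otimes> inv c \<otimes> (a \<otimes> c) \<otimes> t"
    unfolding c(3) using c(1) assms by (simp add: m_assoc inv_mult_group)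
  also have "\<dots> = inv t \<otimes> a \<otimes> t"
    unfolding c(2) using c(1) assms by (simp add: m_assoc inv_mult_cancel)
  finally show "inv g \<otimes> a \<otimes> g = inv t \<otimes> a \<otimes> t" .
next
  assume eq: "inv g \<otimes> a \<otimes> g = inv t \<otimes> a \<otimes> t"
  have "a \<otimes> (g \<otimes> inv t) = g \<otimes> (inv g \<otimes> a \<otimes> g) \<otimes> inv t"
    using assms by (simp add: m_assoc[symmetric])
  also have "\<dots> = (g \<otimes> inv t) \<otimes> a"
    unfolding eq using assms by (simp add: m_assoc)
  finally have "g \<otimes> inv t \<in> centralizer a"
    using assms by (simp add: centralizer_def)
  then show "g \<in> centralizer a #> t"
    using assms unfolding r_coset_def by (force simp: m_assoc)
qed

text \<open>
  The map \<open>g \<mapsto> g\<inverse>ag\<close> is constant on each right coset of the centralizer of \<open>a\<close> and has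
  the conjugacy class of \<open>a\<close> as its range.
\<close>

lemma (in icc_group) infinite_index_centralizer:
  assumes a: "a \<in> carrier G" "a \<noteq> \<one>"
  shows "infinite (rcosets (centralizer a))"
proof
  assume fin: "finite (rcosets (centralizer a))"
  define \<phi> where "\<phi> C = (\<lambda>g. inv g \<otimes> a \<otimes> g) ` C" for C
  have "conjugacy_class G a \<subseteq> \<Union> (\<phi> ` (rcosets (centralizer a)))"
  proof
    fix y assume "y \<in> conjugacy_class G a"
    then obtain g where g: "g \<in> carrier G" "y = g \<otimes> a \<otimes> inv g"
      by (auto simp: conjugacy_class_def)
    have "inv g \<in> centralizer a #> inv g"
      using g a conj_eq_iff_mem_centralizer_coset by simp
    then show "y \<in> \<Union> (\<phi> ` (rcosets (centralizer a)))"
      using g unfolding \<phi>_def RCOSETS_def by (force intro!: image_eqI)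
  qed
  moreover have "finite (\<phi> C)" if C: "C \<in> rcosets (centralizer a)" for C
  proof -
    obtain t where t: "t \<in> carrier G" "C = centralizer a #> t"
      using C by (auto simp: RCOSETS_def)
    have "\<phi> C \<subseteq> {inv t \<otimes> a \<otimes> t}"
      using t a conj_eq_iff_mem_centralizer_coset[OF a(1) _ t(1)]
        r_coset_subset_G[of "centralizer a" t] subgroup.subset[OF subgroup_centralizer]
      unfolding \<phi>_def by blast
    then show ?thesis using finite_subset by blast
  qed
  ultimately have "finite (conjugacy_class G a)"
    using fin by (meson finite_UN_I finite_subset)
  then show False using infinite_conjugacy_class a by blast
qed

text \<open>
  A pair \<open>(a, b)\<close> encodes the equation \<open>g\<inverse>ag = b\<close>, to be avoided by \<open>g\<close>.
\<close>

definition (in group) conj_avoids :: "('a \<times> 'a) set \<Rightarrow> 'a \<Rightarrow> bool" where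
  "conj_avoids P g \<longleftrightarrow> (\<forall>(a, b)\<in>P. inv g \<otimes> a \<otimes> g \<noteq> b)"

lemma (in group) conj_avoidsD:
  "conj_avoids P g \<Longrightarrow> (a, b) \<in> P \<Longrightarrow> inv g \<otimes> a \<otimes> g \<noteq> b"
  by (auto simp: conj_avoids_def)

lemma (in group) conj_avoids_subset:
  "conj_avoids Q g \<Longrightarrow> P \<subseteq> Q \<Longrightarrow> conj_avoids P g"
  by (auto simp: conj_avoids_def)

text \<open>
  The solutions of each equation lie in a single coset of a subgroup of infinite index,
  so Neumann's lemma applies.
\<close>

lemma (in icc_group) ex_conj_avoids:
  assumes P: "finite P" "P \<subseteq> (carrier G - {\<one>}) \<times> carrier G"
  shows "\<exists>g\<in>carrier G. conj_avoids P g"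
proof (rule ccontr)
  assume none: "\<not> ?thesis"
  define \<H> where "\<H> = (\<lambda>(a, b). centralizer a) ` P"
  define rep where "rep = (\<lambda>(a, b). SOME t. t \<in> carrier G \<and> inv t \<otimes> a \<otimes> t = b)"
  \<comment> \<open>An unsolvable equation gives an arbitrary \<open>rep\<close>, possibly outside the group.\<close>
  define T where "T H = rep ` P \<inter> carrier G" for H :: "'a set"
  have "carrier G \<subseteq> (\<Union>H\<in>\<H>. \<Union>t\<in>T H. H #> t)"
  proof
    fix g assume g: "g \<in> carrier G"
    then obtain a b where ab: "(a, b) \<in> P" "inv g \<otimes> a \<otimes> g = b"
      using none unfolding conj_avoids_def by blast
    let ?t = "rep (a, b)"
    have t: "?t \<in> carrier G \<and> inv ?t \<otimes> a \<otimes> ?t = b"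
      unfolding rep_def prod.case by (rule someI[of _ g]) (use g ab in blast)
    then have "g \<in> centralizer a #> ?t"
      using conj_eq_iff_mem_centralizer_coset[of a g ?t] g ab P by auto
    moreover have "centralizer a \<in> \<H>" "?t \<in> T (centralizer a)"
      using ab t unfolding \<H>_def T_def by (force, blast)
    ultimately show "g \<in> (\<Union>H\<in>\<H>. \<Union>t\<in>T H. H #> t)" by blast
  qed
  moreover have "subgroup H G \<and> infinite (rcosets H)" if H: "H \<in> \<H>" for H
  proof -
    obtain a b where ab: "(a, b) \<in> P" "H = centralizer a"
      using H unfolding \<H>_def by auto
    then have "a \<in> carrier G" "a \<noteq> \<one>" using P(2) by auto
    with ab show ?thesis using subgroup_centralizer infinite_index_centralizer by simp
  qed
  moreover have "finite \<H>" "finite (T H) \<and> T H \<subseteq> carrier G" for H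
    using P unfolding \<H>_def T_def by auto
  ultimately show False
    using not_covered_by_cosets_of_infinite_index[of \<H> T] by blast
qed

section \<open>Inverting a fixed element on both sides\<close>

text \<open>
  The hypothesis on \<open>r \<in> {s, t, st}\<close> is equivalent to \<open>xrx = r\<inverse>\<close>. Since inversion reverses
  products, \<open>xstx = (st)\<inverse> = t\<inverse>s\<inverse> = (xtx)(xsx)\<close>, and cancelling the outer factors \<open>x\<close> leaves
  \<open>st = tx\<^sup>2s\<close>.
\<close>

lemma (in group) conj_of_inverted_products:
  assumes mem: "x \<in> carrier G" "s \<in> carrier G" "t \<in> carrier G"
    and s: "s \<otimes> x \<otimes> s = inv x" and t: "t \<otimes> x \<otimes> t = inv x"
    and st: "(s \<otimes> t) \<otimes> x \<otimes> (s \<otimes> t) = inv x"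
  shows "inv t \<otimes> s \<otimes> t = x \<otimes> x \<otimes> s"
proof -
  have flip: "x \<otimes> r \<otimes> x = inv r" if "r \<in> carrier G" "r \<otimes> x \<otimes> r = inv x" for r
  proof -
    have "(x \<otimes> r \<otimes> x) \<otimes> r = x \<otimes> (r \<otimes> x \<otimes> r)"
      using that mem by (simp add: m_assoc)
    then show ?thesis using that mem by (simp add: inv_equality)
  qed
  have "x \<otimes> (s \<otimes> t) \<otimes> x = inv t \<otimes> inv s"
    using flip[of "s \<otimes> t"] st mem by (simp add: inv_mult_group)
  also have "\<dots> = (x \<otimes> t \<otimes> x) \<otimes> (x \<otimes> s \<otimes> x)"
    using flip s t mem by simp
  finally have "x \<otimes> (s \<otimes> t) \<otimes> x = x \<otimes> (t \<otimes> x \<otimes> x \<otimes> s) \<otimes> x"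
    using mem by (simp add: m_assoc)
  then have "s \<otimes> t = t \<otimes> x \<otimes> x \<otimes> s"
    using mem by simp
  then show ?thesis
    using mem by (simp add: m_assoc inv_mult_cancel)
qed

lemma ex_sequence_avoiding_predecessors:
  assumes "\<And>L. finite L \<Longrightarrow> L \<subseteq> A \<Longrightarrow> \<exists>y\<in>A. R L y"
  shows "\<exists>f :: nat \<Rightarrow> 'a. \<forall>n. f n \<in> A \<and> R (f ` {..<n}) (f n)"
proof -
  have "\<exists>f :: nat \<Rightarrow> 'a. \<forall>n. f n \<in> A \<and> R (f ` {..<n}) (f n)"
  proof (rule dependent_wf_choice[OF wf_less,
          where P = "\<lambda>f n y. y \<in> A \<and> R (f ` {..<n}) y"])
    fix f g :: "nat \<Rightarrow> 'a" and n y
    assume "\<And>m. (m, n) \<in> {(x, y). x < y} \<Longrightarrow> f m = g m"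
    then have "f ` {..<n} = g ` {..<n}" by (intro image_cong) auto
    then show "(y \<in> A \<and> R (f ` {..<n}) y) = (y \<in> A \<and> R (g ` {..<n}) y)" by simp
  next
    fix n and f :: "nat \<Rightarrow> 'a"
    assume "\<And>m. (m, n) \<in> {(x, y). x < y} \<Longrightarrow> f m \<in> A \<and> R (f ` {..<m}) (f m)"
    then have "f ` {..<n} \<subseteq> A" by auto
    then show "\<exists>y. y \<in> A \<and> R (f ` {..<n}) y" using assms by blast
  qed
  then show ?thesis .
qed

lemma Ramsey_triangle:
  fixes col :: "nat \<Rightarrow> nat \<Rightarrow> 'c"
  assumes "finite C" and col: "\<And>i j. i < j \<Longrightarrow> col i j \<in> C"
  shows "\<exists>i j k. i < j \<and> j < k \<and> col j k = col i j \<and> col i k = col i j"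
proof -
  obtain idx :: "'c \<Rightarrow> nat" and n where idx: "idx ` C = {i. i < n}" "inj_on idx C"
    using finite_imp_inj_to_nat_seg[OF \<open>finite C\<close>] by blast
  define f where "f X = idx (col (Min X) (Max X))" for X
  have f_eq: "f {i, j} = idx (col i j)" if "i < j" for i j
    using that by (simp add: f_def min_def max_def)
  have "f {i, j} < n" if "i \<noteq> j" for i j
    using that f_eq[of i j] f_eq[of j i] col idx(1)
    by (metis imageI insert_commute linorder_less_linear mem_Collect_eq)
  then obtain Y c where Y: "infinite Y" "\<And>i j. i \<in> Y \<Longrightarrow> j \<in> Y \<Longrightarrow> i \<noteq> j \<Longrightarrow> f {i, j} = c"
    using Ramsey2[OF infinite_UNIV_nat, of f n] by auto
  obtain i j k where ijk: "i \<in> Y" "j \<in> Y" "k \<in> Y" "i < j" "j < k"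
    using Y(1) infinite_nat_iff_unbounded by (metis finite.emptyI)
  have "idx (col j k) = c" "idx (col i j) = c" "idx (col i k) = c"
    using Y(2) f_eq ijk by (metis less_trans less_irrefl)+
  then have "col j k = col i j" "col i k = col i j"
    using inj_onD[OF idx(2)] col ijk by (metis less_trans)+
  then show ?thesis using ijk by blast
qed

text \<open>
  An equation for \<open>h\<inverse>g\<close> is one for \<open>g\<close>, since
  \<open>(h\<inverse>g)\<inverse>a(h\<inverse>g) = g\<inverse>(hah\<inverse>)g\<close>. This form extends a finite part \<open>L\<close> of a generic
  sequence by one element.
\<close>

lemma (in icc_group) ex_translates_conj_avoid:
  assumes L: "finite L" "L \<subseteq> carrier G"
    and W: "\<And>h. h \<in> L \<Longrightarrow> finite (W h)"
      "\<And>h. h \<in> L \<Longrightarrow> W h \<subseteq> (carrier G - {\<one>}) \<times> carrier G"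
  shows "\<exists>g\<in>carrier G. \<forall>h\<in>L. conj_avoids (W h) (inv h \<otimes> g)"
proof -
  define Q where "Q = (\<Union>h\<in>L. (\<lambda>(a, b). (h \<otimes> a \<otimes> inv h, b)) ` W h)"
  have "(h \<otimes> a \<otimes> inv h, b) \<in> (carrier G - {\<one>}) \<times> carrier G"
    if "h \<in> L" "(a, b) \<in> W h" for h a b
  proof -
    have mem: "h \<in> carrier G" "a \<in> carrier G" "b \<in> carrier G" "a \<noteq> \<one>"
      using that L W(2) by blast+
    then have "h \<otimes> a \<otimes> inv h \<noteq> \<one>" by (simp add: inv_solve_right')
    then show ?thesis using mem by simp
  qed
  then have "Q \<subseteq> (carrier G - {\<one>}) \<times> carrier G"
    unfolding Q_def by fastforce
  moreover have "finite Q" unfolding Q_def using L W(1) by simp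
  ultimately obtain g where g: "g \<in> carrier G" "conj_avoids Q g"
    using ex_conj_avoids[of Q] by blast
  have "conj_avoids (W h) (inv h \<otimes> g)" if h: "h \<in> L" for h
    unfolding conj_avoids_def
  proof safe
    fix a assume ab: "(a, inv (inv h \<otimes> g) \<otimes> a \<otimes> (inv h \<otimes> g)) \<in> W h"
    let ?b = "inv (inv h \<otimes> g) \<otimes> a \<otimes> (inv h \<otimes> g)"
    have mem: "h \<in> carrier G" "a \<in> carrier G" using ab h L W(2) by blast+
    have "(h \<otimes> a \<otimes> inv h, ?b) \<in> Q"
      unfolding Q_def using h ab by force
    then have "inv g \<otimes> (h \<otimes> a \<otimes> inv h) \<otimes> g \<noteq> ?b"
      by (rule conj_avoidsD[OF g(2)])
    then show False using mem g(1) by (simp add: inv_mult_group m_assoc)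
  qed
  then show ?thesis using g(1) by blast
qed

text \<open>
  The equations \<open>sxs = x\<inverse>\<close> are handled by the Ramsey argument: a monochromatic triangle
  would satisfy the conclusion of \<open>conj_of_inverted_products\<close>, which the generic sequence
  is built to avoid.
\<close>

lemma (in icc_group) ex_conj_avoids_not_inverting:
  assumes F: "finite F" "F \<subseteq> carrier G"
    and P: "finite P" "P \<subseteq> (carrier G - {\<one>}) \<times> carrier G"
  shows "\<exists>s\<in>carrier G. conj_avoids P s \<and> (\<forall>x\<in>F. s \<otimes> x \<otimes> s \<noteq> inv x)"
proof (rule ccontr)
  assume "\<not> ?thesis"
  then have inverting: "\<exists>x\<in>F. s \<otimes> x \<otimes> s = inv x" if "s \<in> carrier G" "conj_avoids P s" for s
    using that by blast
  obtain a0 where a0: "a0 \<in> carrier G" "a0 \<noteq> \<one>" using nontrivial by blast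
  \<comment> \<open>The equation \<open>(a0, a0)\<close> keeps the new quotients different from \<open>\<one>\<close>, so that the
    sequence is injective. The pairs in the image forbid \<open>t\<inverse>st = x\<^sup>2s\<close> for
    \<open>s = h\<inverse>k\<close> and \<open>t = k\<inverse>g\<close>.\<close>
  define W where "W L k = insert (a0, a0) P \<union>
    (\<lambda>(h, x). (inv h \<otimes> k, x \<otimes> x \<otimes> (inv h \<otimes> k))) ` ((L - {k}) \<times> F)" for L k
  define R where "R L g \<longleftrightarrow> (\<forall>k\<in>L. conj_avoids (W L k) (inv k \<otimes> g))" for L g
  have "\<exists>g\<in>carrier G. R L g" if L: "finite L" "L \<subseteq> carrier G" for L
    unfolding R_def
  proof (rule ex_translates_conj_avoid[OF L])
    fix k assume k: "k \<in> L"
    show "finite (W L k)" unfolding W_def using L F P by simp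
    have "(inv h \<otimes> k, x \<otimes> x \<otimes> (inv h \<otimes> k)) \<in> (carrier G - {\<one>}) \<times> carrier G"
      if "h \<in> L - {k}" "x \<in> F" for h x
    proof -
      have mem: "h \<in> carrier G" "k \<in> carrier G" "x \<in> carrier G" "h \<noteq> k"
        using that k L F by auto
      then have "inv h \<otimes> k \<noteq> \<one>" by (simp add: inv_solve_left')
      then show ?thesis using mem by simp
    qed
    then show "W L k \<subseteq> (carrier G - {\<one>}) \<times> carrier G"
      unfolding W_def using a0 P by (simp add: image_subset_iff split_beta)
  qed
  then obtain g :: "nat \<Rightarrow> 'a" where g: "\<And>n. g n \<in> carrier G" "\<And>n. R (g ` {..<n}) (g n)"
    using ex_sequence_avoiding_predecessors[of "carrier G" R] by blast
  have avoid: "conj_avoids (W (g ` {..<j}) (g i)) (inv (g i) \<otimes> g j)" if "i < j" for i j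
    using g(2)[of j] that unfolding R_def by blast
  define col where "col i j = (SOME x. x \<in> F \<and>
    (inv (g i) \<otimes> g j) \<otimes> x \<otimes> (inv (g i) \<otimes> g j) = inv x)" for i j
  have col: "col i j \<in> F \<and>
      (inv (g i) \<otimes> g j) \<otimes> col i j \<otimes> (inv (g i) \<otimes> g j) = inv (col i j)" if "i < j" for i j
  proof -
    have "conj_avoids P (inv (g i) \<otimes> g j)"
      using conj_avoids_subset[OF avoid[OF that]] unfolding W_def by blast
    moreover have "inv (g i) \<otimes> g j \<in> carrier G" using g(1) by simp
    ultimately have "\<exists>x. x \<in> F \<and>
        (inv (g i) \<otimes> g j) \<otimes> x \<otimes> (inv (g i) \<otimes> g j) = inv x"
      using inverting by blast
    then show ?thesis unfolding col_def by (rule someI_ex)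
  qed
  obtain i j k where ijk: "i < j" "j < k" "col j k = col i j" "col i k = col i j"
    using Ramsey_triangle[of F col] F col by blast
  let ?s = "inv (g i) \<otimes> g j" and ?t = "inv (g j) \<otimes> g k" and ?x = "col i j"
  have "?x \<in> carrier G" using col ijk F by blast
  moreover have "?s \<otimes> ?t = inv (g i) \<otimes> g k"
    using g(1) by (simp add: m_assoc inv_mult_cancel)
  ultimately have "inv ?t \<otimes> ?s \<otimes> ?t = ?x \<otimes> ?x \<otimes> ?s"
    using col[of i j] col[of j k] col[of i k] ijk g(1)
    by (intro conj_of_inverted_products) auto
  moreover have "g i \<noteq> g j"
  proof
    assume "g i = g j"
    moreover have "inv ?s \<otimes> a0 \<otimes> ?s \<noteq> a0"
      by (rule conj_avoidsD[OF avoid[OF ijk(1)]]) (simp add: W_def)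
    ultimately show False using g(1) a0 by simp
  qed
  then have "(?s, ?x \<otimes> ?x \<otimes> ?s) \<in> W (g ` {..<k}) (g j)"
    using col[OF ijk(1)] ijk unfolding W_def
    by (intro UnI2 image_eqI[where x = "(g i, ?x)"]) auto
  ultimately show False
    using conj_avoidsD[OF avoid[OF ijk(2)]] by blast
qed

section \<open>Superswitching elements\<close>

lemma (in icc_group) infinite_superswitching_set:
  assumes "Z \<subseteq> carrier G" and "finite Z"
  shows "infinite (superswitching_set G Z)"
proof
  assume fin: "finite (superswitching_set G Z)"
  let ?S = "superswitching_set G Z"
  have S: "?S \<subseteq> carrier G" by (auto simp: superswitching_set_def superswitching_def)
  have Z: "x \<in> carrier G" if "x \<in> Z" for x using that assms by blast
  obtain a0 where a0: "a0 \<in> carrier G" "a0 \<noteq> \<one>" using nontrivial by blast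
  \<comment> \<open>The first part excludes the finitely many superswitching elements, the second part
    encodes \<open>\<sigma>x\<sigma>\<inverse> = y\<close> and a consequence of \<open>\<sigma>x\<sigma> = y\<close>.\<close>
  define P where "P = (\<lambda>s. (a0, inv s \<otimes> a0 \<otimes> s)) ` ?S \<union>
    {p \<in> (\<lambda>(x, y). (y, x)) ` (Z \<times> Z) \<union> (\<lambda>(x, y). (y \<otimes> x, x \<otimes> y)) ` (Z \<times> Z). fst p \<noteq> \<one>}"
  have "finite P" using fin assms unfolding P_def by simp
  moreover have "P \<subseteq> (carrier G - {\<one>}) \<times> carrier G"
    using a0 S Z unfolding P_def by auto
  ultimately obtain s where s: "s \<in> carrier G" "conj_avoids P s"
      "\<And>x. x \<in> Z \<Longrightarrow> s \<otimes> x \<otimes> s \<noteq> inv x"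
    using ex_conj_avoids_not_inverting[of Z P] assms by blast
  note avoid = conj_avoidsD[OF s(2)]
  have "s \<notin> ?S"
    using avoid[of a0 "inv s \<otimes> a0 \<otimes> s"] unfolding P_def by blast
  then obtain x y and e :: int where xy: "x \<in> Z" "y \<in> Z" "\<not> (x = \<one> \<and> y = \<one>)"
      and e: "e \<in> {1, -1}" "s \<otimes> x \<otimes> (s [^] e) = y"
    using s unfolding superswitching_set_def superswitching_def by blast
  have mem: "x \<in> carrier G" "y \<in> carrier G" using xy Z by auto
  consider "s \<otimes> x \<otimes> inv s = y" | "s \<otimes> x \<otimes> s = y"
    using e s by (auto simp: int_pow_neg)
  then show False
  proof cases
    case 1
    have conj_s: "inv s \<otimes> y \<otimes> s = x"
      unfolding 1[symmetric] using mem s by (simp add: m_assoc inv_mult_cancel)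
    have "y \<noteq> \<one>"
    proof
      assume "y = \<one>"
      then show False using conj_s xy s by simp
    qed
    then have "(y, x) \<in> P" using xy unfolding P_def by force
    then show False using avoid conj_s by blast
  next
    case 2
    have conj_s: "inv s \<otimes> (y \<otimes> x) \<otimes> s = x \<otimes> y"
      unfolding 2[symmetric] using mem s by (simp add: m_assoc inv_mult_cancel)
    have "y \<otimes> x \<noteq> \<one>"
    proof
      assume "y \<otimes> x = \<one>"
      then have "y = inv x" using mem by (simp add: inv_equality)
      then show False using 2 s xy by blast
    qed
    then have "(y \<otimes> x, x \<otimes> y) \<in> P" using xy unfolding P_def by force
    then show False using avoid conj_s by blast
  qed
qed

theorem proposition4p25:
  fixes G :: "('a, 'b) monoid_scheme" and Z :: "'a set"
  assumes "icc_group G" and "Z \<subseteq> carrier G" and "finite Z"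
  shows "infinite (superswitching_set G Z)"
  using assms by (rule icc_group.infinite_superswitching_set)

end
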